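(* Let $I(x)$ be the independence polynomial of $\varGamma(\mathbb{Z}_{p^2q})$, where $p<q$ are primes. Then all complex zeros of $I(x)$ different from $x=-1$ lie in the annular region $$\left\{x\in\mathbb{C}:\frac12<|1+x|<2\right\}.$$
   Context: For a positive integer $n$, the zero divisor graph $\varGamma(\mathbb{Z}_n)$ is the simple undirected graph whose vertices are the non-zero zero divisors of the ring $\mathbb{Z}_n$ of integers modulo $n$ (non-zero $a$ such that $ab=0$ for some non-zero $b$), two distinct vertices $a,b$ being adjacent if and only if $ab=0$ in $\mathbb{Z}_n$. An independent set of a finite graph $G$ is a set of vertices no two of which are adjacent (the empty set included); $\alpha(G)$ is the maximum size of an independent set, and $s_k(G)$ is the number of independent sets of size $k$. The independence polynomial of $G$ is $I(G,x)=\sum_{k=0}^{\alpha(G)} s_k(G)x^k$. *)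

theory Defs
  imports
    Complex_Main
    "HOL-Computational_Algebra.Polynomial"
    "HOL-Number_Theory.Residues"
begin

(* A graph is a pair of a vertex set and a set of edges, an edge {a, b} being an unordered
   pair of distinct vertices. *)
type_synonym 'a graph = "'a set \<times> 'a set set"

definition independent_set :: "'a graph \<Rightarrow> 'a set \<Rightarrow> bool" where
  "independent_set G S \<longleftrightarrow> S \<subseteq> fst G \<and> (\<forall>a\<in>S. \<forall>b\<in>S. {a, b} \<notin> snd G)"

(* The next three definitions are meant for graphs with a finite vertex set. *)
definition independence_number :: "'a graph \<Rightarrow> nat" where
  "independence_number G = Max (card ` {S. independent_set G S})"

definition num_independent_sets :: "'a graph \<Rightarrow> nat \<Rightarrow> nat" where
  "num_independent_sets G k = card {S. independent_set G S \<and> card S = k}"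

definition independence_poly :: "'a graph \<Rightarrow> complex poly" where
  "independence_poly G =
     (\<Sum>k = 0..independence_number G. Polynomial.monom (of_nat (num_independent_sets G k)) k)"

definition nonzero_zero_divisors :: "('a, 'b) ring_scheme \<Rightarrow> 'a set" where
  "nonzero_zero_divisors R =
     {a \<in> carrier R - {\<zero>\<^bsub>R\<^esub>}. \<exists>b \<in> carrier R - {\<zero>\<^bsub>R\<^esub>}. a \<otimes>\<^bsub>R\<^esub> b = \<zero>\<^bsub>R\<^esub>}"

definition zero_divisor_graph :: "('a, 'b) ring_scheme \<Rightarrow> 'a graph" where
  "zero_divisor_graph R =
     (nonzero_zero_divisors R,
      {{a, b} | a b. a \<in> nonzero_zero_divisors R \<and> b \<in> nonzero_zero_divisors R \<and>
                     a \<noteq> b \<and> a \<otimes>\<^bsub>R\<^esub> b = \<zero>\<^bsub>R\<^esub>})"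

end

(* Write n = p^2 q. Whether a b = 0 in Z_n depends only on gcd(a, n) and gcd(b, n), so the vertices
   fall into four blocks, with gcd p, q, p^2 and p q. The block of p q is a clique joined to those of
   p and p^2, and the blocks of q and p^2 are completely joined; there are no other edges. With
   y = 1 + x, d = p - 1, c = q - 1 and b = p (p - 1), counting independent sets gives
     I = y^(d c) (y^b + y^c - 1) + d (y - 1) y^b,
   so a zero y other than 0 satisfies y^(d (c - p)) (y^b + y^c - 1) = - d (y - 1). Unless (p, q) = (2, 3),
   comparing absolute values excludes |y| <= 1/2, where the left-hand side is too small, and
   |y| >= 2, where it is too large. *)

theory Submission
  imports Defs
begin

section \<open>Independence polynomial as a sum over independent sets\<close>

text \<open>Grouping the independent sets by size gives the coefficients; finiteness of the vertex
  set makes \<open>Max\<close> an actual bound on all sizes, so no set is lost.\<close>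

lemma poly_independence_poly:
  assumes "finite (fst G)"
  shows "poly (independence_poly G) x = (\<Sum>S | independent_set G S. x ^ card S)"
proof -
  let ?I = "{S. independent_set G S}"
  have "?I \<subseteq> Pow (fst G)"
    by (auto simp: independent_set_def)
  then have fin: "finite ?I"
    using assms finite_subset by blast
  have "poly (independence_poly G) x =
      (\<Sum>k = 0..independence_number G. of_nat (num_independent_sets G k) * x ^ k)"
    by (simp add: independence_poly_def poly_sum poly_monom)
  also have "\<dots> = (\<Sum>k = 0..independence_number G. \<Sum>S\<in>{S \<in> ?I. card S = k}. x ^ card S)"
    by (intro sum.cong) (auto simp: num_independent_sets_def)
  also have "\<dots> = (\<Sum>S\<in>?I. x ^ card S)"
    by (intro sum.group) (use fin in \<open>auto simp: independence_number_def\<close>)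
  finally show ?thesis .
qed

text \<open>Expand the product of \<open>x + 1\<close> over \<open>A\<close>: each subset records
  the factors from which \<open>x\<close> is chosen.\<close>

lemma sum_Pow_power_card:
  fixes x :: "'a :: comm_semiring_1"
  assumes "finite A"
  shows "(\<Sum>S\<in>Pow A. x ^ card S) = (1 + x) ^ card A"
  using prod_add[OF assms, of "\<lambda>_. x" "\<lambda>_. 1"] by (simp add: add.commute)

text \<open>The blocks \<open>A\<close>, \<open>B\<close>, \<open>C\<close>, \<open>D\<close> stand
  for the vertices with gcd p, q, p^2 and p q. An independent set that avoids \<open>D\<close>
  cannot meet both \<open>B\<close> and \<open>C\<close>; one that contains some \<open>u\<close> in
  \<open>D\<close> has all its other elements in \<open>B\<close>, since \<open>u\<close> is
  adjacent to everything else.\<close>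

lemma independence_poly_blocks:
  fixes x :: complex
  assumes fin: "finite A" "finite B" "finite C" "finite D"
    and disj: "A \<inter> B = {}" "A \<inter> C = {}" "A \<inter> D = {}" "B \<inter> C = {}" "B \<inter> D = {}" "C \<inter> D = {}"
    and vertices: "fst G = A \<union> B \<union> C \<union> D"
    and edges: "\<And>a b. a \<in> fst G \<Longrightarrow> b \<in> fst G \<Longrightarrow> {a, b} \<in> snd G \<longleftrightarrow> a \<noteq> b \<and>
      (a \<in> D \<and> b \<in> A \<union> C \<union> D \<or> b \<in> D \<and> a \<in> A \<union> C \<union> D \<or>
       a \<in> B \<and> b \<in> C \<or> a \<in> C \<and> b \<in> B)"
  shows "poly (independence_poly G) x =
    (1 + x) ^ card A * ((1 + x) ^ card B + (1 + x) ^ card C - 1) +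
    of_nat (card D) * x * (1 + x) ^ card B"
proof -
  define w where "w S = x ^ card S" for S :: "'a set"
  let ?U = "Pow (A \<union> B) \<union> Pow (A \<union> C)" and ?W = "\<Union>u\<in>D. insert u ` Pow B"
  have indep: "{S. independent_set G S} = ?U \<union> ?W"
  proof (intro equalityI subsetI)
    fix S assume "S \<in> {S. independent_set G S}"
    then have V: "S \<subseteq> fst G" and free: "\<And>a b. a \<in> S \<Longrightarrow> b \<in> S \<Longrightarrow> {a, b} \<notin> snd G"
      by (auto simp: independent_set_def)
    have E: "\<not> (a \<noteq> b \<and>
      (a \<in> D \<and> b \<in> A \<union> C \<union> D \<or> b \<in> D \<and> a \<in> A \<union> C \<union> D \<or>
       a \<in> B \<and> b \<in> C \<or> a \<in> C \<and> b \<in> B))" if "a \<in> S" "b \<in> S" for a b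
      using edges[of a b] free[OF that] that V by blast
    show "S \<in> ?U \<union> ?W"
    proof (cases "S \<inter> D = {}")
      case True
      have "S \<inter> B = {} \<or> S \<inter> C = {}"
        using E disj by blast
      then show ?thesis
        using True V vertices by blast
    next
      case False
      then obtain u where u: "u \<in> S" "u \<in> D"
        by blast
      have "S - {u} \<subseteq> B"
        using E[of _ u] u V vertices by blast
      moreover have "S = insert u (S - {u})"
        using u by blast
      ultimately show ?thesis
        using u by blast
    qed
  next
    fix S assume S: "S \<in> ?U \<union> ?W"
    then have V: "S \<subseteq> fst G"
      using vertices by blast
    have "{a, b} \<notin> snd G" if "a \<in> S" "b \<in> S" for a b
    proof -
      have D: "v \<in> A \<Longrightarrow> v \<notin> B \<and> v \<notin> C \<and> v \<notin> D" "v \<in> B \<Longrightarrow> v \<notin> C \<and> v \<notin> D"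
        "v \<in> C \<Longrightarrow> v \<notin> D" for v
        using disj by auto
      consider "S \<subseteq> A \<union> B" | "S \<subseteq> A \<union> C" | u where "u \<in> D" "S \<subseteq> insert u B"
        using S by blast
      then have "\<not> (a \<noteq> b \<and>
        (a \<in> D \<and> b \<in> A \<union> C \<union> D \<or> b \<in> D \<and> a \<in> A \<union> C \<union> D \<or>
         a \<in> B \<and> b \<in> C \<or> a \<in> C \<and> b \<in> B))"
        by cases (use that D in blast)+
      then show ?thesis
        using edges[of a b] V that by blast
    qed
    with V show "S \<in> {S. independent_set G S}"
      by (simp add: independent_set_def)
  qed
  have finU: "finite ?U" and finW: "finite ?W"
    using fin by auto
  have "S \<inter> D = {}" if "S \<in> ?U" for S
    using that disj by auto
  moreover have "S \<inter> D \<noteq> {}" if "S \<in> ?W" for S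
    using that by auto
  \<comment> \<open>Whether a set meets \<open>D\<close> separates the two families.\<close>
  ultimately have "?U \<inter> ?W = {}"
    by blast
  then have "poly (independence_poly G) x = sum w ?U + sum w ?W"
    using fin vertices finU finW
    by (simp add: poly_independence_poly indep w_def[symmetric] sum.union_disjoint)
  moreover have "sum w ?U = (1 + x) ^ card A * ((1 + x) ^ card B + (1 + x) ^ card C - 1)"
  proof -
    \<comment> \<open>Inclusion-exclusion: the subsets of \<open>A\<close> are counted in both power
      sets, which produces the term -1 in the factor.\<close>
    have "(A \<union> B) \<inter> (A \<union> C) = A"
      using disj by auto
    then have "Pow (A \<union> B) \<inter> Pow (A \<union> C) = Pow A"
      by (simp flip: Pow_Int_eq)
    then have "sum w ?U = sum w (Pow (A \<union> B)) + sum w (Pow (A \<union> C)) - sum w (Pow A)"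
      using fin by (subst sum_Un) auto
    then show ?thesis
      using fin disj
      by (simp add: w_def sum_Pow_power_card card_Un_disjoint power_add algebra_simps)
  qed
  moreover have "sum w ?W = of_nat (card D) * x * (1 + x) ^ card B"
  proof -
    \<comment> \<open>The union is disjoint because \<open>u\<close> is the only element of
      \<open>D\<close> in each of its sets.\<close>
    have "sum w ?W = (\<Sum>u\<in>D. sum w (insert u ` Pow B))"
      using fin disj by (intro sum.UNION_disjoint) auto
    also have "\<dots> = (\<Sum>u\<in>D. x * (1 + x) ^ card B)"
    proof (rule sum.cong[OF refl])
      fix u assume "u \<in> D"
      then have u: "u \<notin> B"
        using disj by blast
      then have "inj_on (insert u) (Pow B)"
        by (auto simp: inj_on_def)
      then have "sum w (insert u ` Pow B) = (\<Sum>S\<in>Pow B. w (insert u S))"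
        by (simp add: sum.reindex)
      also have "\<dots> = (\<Sum>S\<in>Pow B. x * x ^ card S)"
      proof (rule sum.cong[OF refl])
        fix S assume "S \<in> Pow B"
        then have "finite S" "u \<notin> S"
          using fin u finite_subset by auto
        then show "w (insert u S) = x * x ^ card S"
          by (simp add: w_def)
      qed
      also have "\<dots> = x * (1 + x) ^ card B"
        using fin by (simp add: sum_distrib_left[symmetric] sum_Pow_power_card)
      finally show "sum w (insert u ` Pow B) = x * (1 + x) ^ card B" .
    qed
    finally show ?thesis
      by simp
  qed
  ultimately show ?thesis
    by simp
qed

section \<open>Zero divisors modulo n in terms of gcds\<close>

text \<open>If n divides a b, it divides gcd(a b, n b) = gcd(a, n) b and also gcd(a, n) n, hence the
  gcd of these two, which is gcd(a, n) gcd(b, n).\<close>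

lemma dvd_mult_iff_dvd_gcd_mult_gcd:
  fixes a b n :: nat
  shows "n dvd a * b \<longleftrightarrow> n dvd gcd a n * gcd b n"
proof
  assume "n dvd a * b"
  then have "n dvd gcd (a * b) (n * b)" "n dvd gcd (a * n) (n * n)"
    by auto
  then have "n dvd gcd a n * b" "n dvd gcd a n * n"
    by (simp_all only: gcd_mult_distrib_nat mult.commute)
  then have "n dvd gcd (gcd a n * b) (gcd a n * n)"
    by simp
  then show "n dvd gcd a n * gcd b n"
    by (simp add: gcd_mult_distrib_nat)
next
  assume "n dvd gcd a n * gcd b n"
  moreover have "gcd a n * gcd b n dvd a * b"
    by (simp add: mult_dvd_mono)
  ultimately show "n dvd a * b"
    using dvd_trans by blast
qed

text \<open>The range \<open>{0<..n}\<close> is the one over which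
  \<open>card_gcd_eq_totient\<close> counts; its endpoint n drops out because its gcd with n is
  n.\<close>

lemma nonzero_zero_divisors_residue_ring:
  assumes "n > 0"
  shows "nonzero_zero_divisors (residue_ring (int n)) = int ` {k \<in> {0<..n}. gcd k n \<notin> {1, n}}"
proof (intro equalityI subsetI)
  fix a assume "a \<in> nonzero_zero_divisors (residue_ring (int n))"
  then obtain b where ab: "0 < a" "a < int n" "0 < b" "b < int n" "a * b mod int n = 0"
    by (force simp: nonzero_zero_divisors_def residue_ring_def)
  define k l where "k = nat a" and "l = nat b"
  have kl: "a = int k" "b = int l"
    using ab by (simp_all add: k_def l_def)
  with ab have *: "0 < k" "k < n" "0 < l" "l < n" "n dvd k * l"
    by (simp_all flip: of_nat_mult of_nat_mod add: mod_eq_0_iff_dvd)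
  have "gcd k n \<noteq> 1"
    using * coprime_dvd_mult_right_iff[of n k l]
    by (auto simp: coprime_iff_gcd_eq_1 gcd.commute dest: nat_dvd_not_less)
  moreover have "gcd k n \<noteq> n"
    using * by (metis gcd_le1_nat not_less less_numeral_extra(3))
  ultimately show "a \<in> int ` {k \<in> {0<..n}. gcd k n \<notin> {1, n}}"
    using * kl by auto
next
  fix a assume "a \<in> int ` {k \<in> {0<..n}. gcd k n \<notin> {1, n}}"
  then obtain k where k: "a = int k" "0 < k" "k \<le> n" "gcd k n \<noteq> 1" "gcd k n \<noteq> n"
    by auto
  then have "k < n"
    by (cases "k = n") auto
  \<comment> \<open>The annihilating partner of \<open>k\<close>: it lies strictly between 0 and n
    since the gcd exceeds 1, and \<open>k * l\<close> is a multiple of \<open>gcd k n * l\<close>,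
    which is n.\<close>
  define l where "l = n div gcd k n"
  have "gcd k n > 1"
    using k(2,4) by (metis One_nat_def gcd_eq_0_iff less_one linorder_neqE_nat neq0_conv)
  then have l: "0 < l" "l < n"
    using assms by (auto simp: l_def div_greater_zero_iff gcd_le2_nat)
  have "n = gcd k n * l"
    by (simp add: l_def)
  also have "gcd k n * l dvd k * l"
    by (intro mult_dvd_mono) auto
  finally have "int k * int l mod int n = 0"
    by (simp flip: of_nat_mult of_nat_mod)
  then show "a \<in> nonzero_zero_divisors (residue_ring (int n))"
    using k \<open>k < n\<close> l
    by (auto simp: nonzero_zero_divisors_def residue_ring_def intro!: bexI[of _ "int l"])
qed

lemma residue_ring_zero_divisor_edge:
  fixes n i j :: nat
  defines "G \<equiv> zero_divisor_graph (residue_ring (int n))"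
  assumes "int i \<in> fst G" "int j \<in> fst G"
  shows "{int i, int j} \<in> snd G \<longleftrightarrow> i \<noteq> j \<and> n dvd gcd i n * gcd j n"
proof -
  let ?R = "residue_ring (int n)"
  \<comment> \<open>Both orders are required, as an unordered edge may be presented either
    way.\<close>
  have "int i \<otimes>\<^bsub>?R\<^esub> int j = int i * int j mod int n" "int j \<otimes>\<^bsub>?R\<^esub> int i = int i * int j mod int n"
    "\<zero>\<^bsub>?R\<^esub> = 0"
    by (simp_all add: residue_ring_def mult.commute)
  then have "{int i, int j} \<in> snd G \<longleftrightarrow> i \<noteq> j \<and> int i * int j mod int n = 0"
    using assms(2,3) unfolding G_def zero_divisor_graph_def fst_conv snd_conv
    by (smt (verit, best) doubleton_eq_iff mem_Collect_eq of_nat_eq_iff)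
  also have "\<dots> \<longleftrightarrow> i \<noteq> j \<and> n dvd i * j"
    by (simp flip: of_nat_mult of_nat_mod add: mod_eq_0_iff_dvd)
  finally show ?thesis
    using dvd_mult_iff_dvd_gcd_mult_gcd by simp
qed

section \<open>The zero divisor graph for p^2 q\<close>

lemma dvd_prime_square_mult_prime:
  fixes p q d :: nat
  assumes "prime p" "prime q"
  shows "d dvd p\<^sup>2 * q \<longleftrightarrow> d \<in> {1, p, p\<^sup>2, q, p * q, p\<^sup>2 * q}"
proof
  assume "d dvd p\<^sup>2 * q"
  then obtain a b where "d = a * b" "a dvd p\<^sup>2" "b dvd q"
    using division_decomp by blast
  moreover have "a \<in> {1, p, p\<^sup>2}"
    using \<open>a dvd p\<^sup>2\<close> divides_primepow_nat[OF assms(1), of a 2]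
    by (auto simp: le_Suc_eq numeral_2_eq_2)
  moreover have "b \<in> {1, q}"
    using \<open>b dvd q\<close> assms(2) by (auto simp: prime_nat_iff)
  ultimately show "d \<in> {1, p, p\<^sup>2, q, p * q, p\<^sup>2 * q}"
    by auto
qed (auto simp: power2_eq_square)

text \<open>The vertices whose gcd with n is d form the block \<open>L d\<close>, of size
  \<open>totient (n div d)\<close>. The block formula applies with \<open>L p\<close>,
  \<open>L q\<close>, \<open>L (p\<^sup>2)\<close> and \<open>L (p * q)\<close> as \<open>A\<close>,
  \<open>B\<close>, \<open>C\<close> and \<open>D\<close>.\<close>

lemma poly_independence_poly_zero_divisor_graph:
  fixes p q :: nat and x :: complex
  assumes p: "prime p" and q: "prime q" and "p \<noteq> q"
  shows "poly (independence_poly (zero_divisor_graph (residue_ring (int (p\<^sup>2 * q))))) x =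
    (1 + x) ^ ((p - 1) * (q - 1)) * ((1 + x) ^ (p * (p - 1)) + (1 + x) ^ (q - 1) - 1) +
    of_nat (p - 1) * x * (1 + x) ^ (p * (p - 1))"
proof -
  define n where "n = p\<^sup>2 * q"
  define G where "G = zero_divisor_graph (residue_ring (int n))"
  define L where "L d = int ` {k \<in> {0<..n}. gcd k n = d}" for d
  have p1: "p > 1" and q1: "q > 1"
    using p q prime_gt_1_nat by auto
  then have n0: "n > 0"
    by (simp add: n_def)
  have pq: "\<not> p dvd q" "\<not> q dvd p"
    using assms primes_dvd_imp_eq[OF p q] primes_dvd_imp_eq[OF q p] by auto
  then have cop: "coprime p q"
    using p by (simp add: prime_imp_coprime)
  have card: "card (L d) = totient (n div d)" if "d dvd n" for d
    unfolding L_def using card_gcd_eq_totient[OF n0 that] by (simp add: card_image)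
  have cards: "card (L p) = (p - 1) * (q - 1)" "card (L q) = p * (p - 1)"
    "card (L (p\<^sup>2)) = q - 1" "card (L (p * q)) = p - 1"
  proof -
    have "n div p = p * q" "n div q = p\<^sup>2" "n div p\<^sup>2 = q" "n div (p * q) = p"
      using p1 q1 by (simp_all add: n_def power2_eq_square)
    moreover have "p dvd n" "q dvd n" "p\<^sup>2 dvd n" "p * q dvd n"
      by (simp_all add: n_def power2_eq_square)
    ultimately show "card (L p) = (p - 1) * (q - 1)" "card (L q) = p * (p - 1)"
      "card (L (p\<^sup>2)) = q - 1" "card (L (p * q)) = p - 1"
      using p q cop
      by (simp_all add: card totient_mult_coprime totient_prime totient_prime_power)
  qed
  have distinct: "p \<noteq> p\<^sup>2" "q \<noteq> p\<^sup>2" "p * q \<noteq> p" "p * q \<noteq> q" "p * q \<noteq> p\<^sup>2"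
    "p \<noteq> n" "q \<noteq> n" "p\<^sup>2 \<noteq> n" "p * q \<noteq> n"
    using p1 q1 pq \<open>p \<noteq> q\<close> by (auto simp: n_def power2_eq_square)
  have V: "fst G = L p \<union> L q \<union> L (p\<^sup>2) \<union> L (p * q)"
  proof -
    have *: "gcd k n \<in> {1, p, p\<^sup>2, q, p * q, n}" for k
      using dvd_prime_square_mult_prime[OF p q, of "gcd k n"] by (simp add: n_def)
    have "1 \<noteq> p\<^sup>2"
      using p1 by (metis less_irrefl one_less_power pos2)
    moreover have "n \<noteq> 1"
      using p1 q1 by (simp add: n_def)
    ultimately have **: "d \<notin> {1, n} \<longleftrightarrow> d \<in> {p, q, p\<^sup>2, p * q}"
      if "d \<in> {1, p, p\<^sup>2, q, p * q, n}" for d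
      using that distinct p1 q1 by (elim insertE emptyE) simp_all
    have "{k \<in> {0<..n}. gcd k n \<notin> {1, n}} = {k \<in> {0<..n}. gcd k n = p} \<union>
        {k \<in> {0<..n}. gcd k n = q} \<union> {k \<in> {0<..n}. gcd k n = p\<^sup>2} \<union> {k \<in> {0<..n}. gcd k n = p * q}"
      unfolding **[OF *] by blast
    then show ?thesis
      by (simp only: G_def zero_divisor_graph_def L_def fst_conv image_Un
          nonzero_zero_divisors_residue_ring[OF n0])
  qed
  have disjL: "L d \<inter> L e = {}" if "d \<noteq> e" for d e
    using that by (auto simp: L_def)
  \<comment> \<open>Three of these products are powers of p, hence not divisible by q; the other
    three contain p at most once, hence are not divisible by p^2.\<close>
  have ndvd: "\<not> n dvd p * p" "\<not> n dvd p * q" "\<not> n dvd p * p\<^sup>2" "\<not> n dvd q * q"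
    "\<not> n dvd p\<^sup>2 * p\<^sup>2" "\<not> n dvd q * (p * q)"
  proof -
    have "q dvd n" "p\<^sup>2 dvd n"
      by (simp_all add: n_def)
    then have n: "q dvd m" "p * p dvd m" if "n dvd m" for m
      using that dvd_trans by (auto simp: power2_eq_square)
    show "\<not> n dvd p * p" "\<not> n dvd p * p\<^sup>2" "\<not> n dvd p\<^sup>2 * p\<^sup>2"
      using pq(2) q by (auto dest!: n(1) simp: prime_dvd_mult_iff prime_dvd_power_iff)
    have "p * p dvd p * m \<longleftrightarrow> p dvd m" for m
      using p1 by simp
    moreover have "q * (p * q) = p * (q * q)"
      by simp
    moreover have "\<not> p dvd q * q"
      using pq(1) p by (simp add: prime_dvd_mult_iff)
    ultimately show "\<not> n dvd p * q" "\<not> n dvd q * q" "\<not> n dvd q * (p * q)"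
      using n(2) pq(1) dvd_mult_left by metis+
  qed
  have ydvd: "n dvd p * (p * q)" "n dvd p\<^sup>2 * (p * q)" "n dvd (p * q) * (p * q)" "n dvd q * p\<^sup>2"
    by (auto simp: n_def power2_eq_square mult_ac)
  \<comment> \<open>The bracketing copies what \<open>Un_iff\<close> makes of the unions in
    \<open>edges\<close>, so that the two sides there agree by reflexivity.\<close>
  have annih: "n dvd g * h \<longleftrightarrow>
      g = p * q \<and> ((h = p \<or> h = p\<^sup>2) \<or> h = p * q) \<or>
      h = p * q \<and> ((g = p \<or> g = p\<^sup>2) \<or> g = p * q) \<or>
      g = q \<and> h = p\<^sup>2 \<or> g = p\<^sup>2 \<and> h = q"
    if "g \<in> {p, q, p\<^sup>2, p * q}" "h \<in> {p, q, p\<^sup>2, p * q}" for g h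
  proof -
    have comm: "\<not> n dvd q * p" "\<not> n dvd p\<^sup>2 * p" "\<not> n dvd (p * q) * q"
      "n dvd (p * q) * p" "n dvd (p * q) * p\<^sup>2" "n dvd p\<^sup>2 * q"
      using ndvd ydvd by (simp_all only: mult.commute simp_thms)
    note facts = comm ndvd ydvd distinct distinct[symmetric] \<open>p \<noteq> q\<close> \<open>p \<noteq> q\<close>[symmetric]
    show ?thesis
      using that by (elim insertE emptyE) (simp_all only: facts simp_thms)
  qed
  have edges: "{a, b} \<in> snd G \<longleftrightarrow> a \<noteq> b \<and>
      (a \<in> L (p * q) \<and> b \<in> L p \<union> L (p\<^sup>2) \<union> L (p * q) \<or>
       b \<in> L (p * q) \<and> a \<in> L p \<union> L (p\<^sup>2) \<union> L (p * q) \<or>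
       a \<in> L q \<and> b \<in> L (p\<^sup>2) \<or> a \<in> L (p\<^sup>2) \<and> b \<in> L q)"
    if "a \<in> fst G" "b \<in> fst G" for a b
  proof -
    have "\<exists>i. v = int i \<and> i \<in> {0<..n} \<and> gcd i n \<in> {p, q, p\<^sup>2, p * q}" if "v \<in> fst G" for v
      using that unfolding V L_def by blast
    then obtain i j where ij: "a = int i" "b = int j" "i \<in> {0<..n}" "j \<in> {0<..n}"
      "gcd i n \<in> {p, q, p\<^sup>2, p * q}" "gcd j n \<in> {p, q, p\<^sup>2, p * q}"
      using \<open>a \<in> fst G\<close> \<open>b \<in> fst G\<close> by meson
    have edge: "{a, b} \<in> snd G \<longleftrightarrow> i \<noteq> j \<and> n dvd gcd i n * gcd j n"
      using residue_ring_zero_divisor_edge that unfolding G_def ij by blast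
    have mem: "a \<in> L d \<longleftrightarrow> gcd i n = d" "b \<in> L d \<longleftrightarrow> gcd j n = d" for d
      using ij(3,4) by (simp_all add: ij(1,2) L_def image_iff)
    show ?thesis
      unfolding edge mem Un_iff unfolding ij(1,2) of_nat_eq_iff annih[OF ij(5,6)] by (rule refl)
  qed
  have fin: "finite (L d)" for d
    by (simp add: L_def)
  have "poly (independence_poly G) x =
      (1 + x) ^ card (L p) * ((1 + x) ^ card (L q) + (1 + x) ^ card (L (p\<^sup>2)) - 1) +
      of_nat (card (L (p * q))) * x * (1 + x) ^ card (L q)"
    by (intro independence_poly_blocks fin V edges disjL)
      (simp_all only: distinct distinct[symmetric] \<open>p \<noteq> q\<close> not_False_eq_True)
  then show ?thesis
    unfolding cards by (simp add: G_def n_def)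
qed

section \<open>Location of the zeros\<close>

theorem theorem3p3:
  fixes p q :: nat and x :: complex
  assumes "prime p" and "prime q" and "p < q"
    and "poly (independence_poly (zero_divisor_graph (residue_ring (int (p^2 * q))))) x = 0"
    and "x \<noteq> -1"
  shows "x \<in> {z :: complex. 1/2 < cmod (1 + z) \<and> cmod (1 + z) < 2}"
proof -
  define y d c where "y = 1 + x" and "d = p - 1" and "c = q - 1"
  define r where "r = cmod y"
  have p1: "p \<ge> 2"
    using assms(1) prime_ge_2_nat by blast
  then have d1: "d \<ge> 1"
    by (simp add: d_def)
  have "y \<noteq> 0"
    using assms(5) by (metis add_eq_0_iff y_def)
  then have r0: "r > 0"
    by (simp add: r_def)
  have cp: "c \<ge> p"
    using assms(3) by (simp add: c_def)
  have "y ^ (d * c) * (y ^ (p * d) + y ^ c - 1) + of_nat d * (y - 1) * y ^ (p * d) = 0"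
    using poly_independence_poly_zero_divisor_graph[OF assms(1,2), of x] assms(3,4)
    by (simp add: y_def d_def c_def)
  \<comment> \<open>As \<open>c\<close> is at least \<open>p\<close>, the power
    \<open>y ^ (p * d)\<close> is a common factor of both terms and can be cancelled.\<close>
  moreover have exponent: "d * c = d * (c - p) + p * d"
    using cp by (simp add: diff_mult_distrib2 mult.commute)
  ultimately have "y ^ (p * d) * (y ^ (d * (c - p)) * (y ^ (p * d) + y ^ c - 1) +
      of_nat d * (y - 1)) = 0"
    by (simp only: power_add) (simp add: algebra_simps)
  then have root: "y ^ (d * (c - p)) * (y ^ (p * d) + y ^ c - 1) = - (of_nat d * (y - 1))"
    using \<open>y \<noteq> 0\<close> by (simp only: mult_eq_0_iff power_eq_0_iff eq_neg_iff_add_eq_0) blast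
  have "1/2 < r \<and> r < 2"
  proof (cases "p = 2 \<and> q = 3")
    case True
    \<comment> \<open>Here \<open>c = p\<close>, so the factor \<open>y ^ (d * (c - p))\<close> is 1
      and supplies no smallness; the quadratic that remains is treated directly.\<close>
    then have "2 * y ^ 2 = 2 - y"
      using root by (simp add: d_def c_def power2_eq_square algebra_simps)
    then have "cmod (2 * y ^ 2) = cmod (2 - y)"
      by simp
    then have eq: "2 * r ^ 2 = cmod (2 - y)"
      by (simp add: norm_mult norm_power r_def)
    have "2 - r \<le> cmod (2 - y)" "cmod (2 - y) \<le> 2 + r"
      using norm_triangle_ineq2[of 2 y] norm_triangle_ineq4[of 2 y] by (simp_all add: r_def)
    then have lo: "2 - r \<le> 2 * r ^ 2" and hi: "2 * r ^ 2 \<le> 2 + r"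
      using eq by simp_all
    have "r > 1/2"
    proof (rule ccontr)
      assume "\<not> r > 1/2"
      then have "r * r \<le> (1/2) * (1/2)"
        using r0 by (intro mult_mono) auto
      then show False
        using lo \<open>\<not> r > 1/2\<close> by (simp add: power2_eq_square)
    qed
    moreover have "r < 2"
    proof (rule ccontr)
      assume "\<not> r < 2"
      then have "2 * r \<le> r * r"
        by (intro mult_right_mono) auto
      then show False
        using hi \<open>\<not> r < 2\<close> unfolding power2_eq_square by linarith
    qed
    ultimately show ?thesis
      by blast
  next
    case False
    \<comment> \<open>For odd \<open>p\<close>, both \<open>p\<close> and \<open>q\<close> are odd, so \<open>q\<close> is at least \<open>p + 2\<close>.\<close>
    have c4: "c \<ge> 4" and e2: "d * (c - p) \<ge> 2" and "even c"
    proof -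
      have q2: "q > 2"
        using p1 assms(3) by simp
      then have "odd q"
        using assms(2) prime_odd_nat by blast
      then show "even c"
        using q2 by (simp add: c_def)
      have "c \<ge> 4 \<and> d * (c - p) \<ge> 2"
      proof (cases "p = 2")
        case True
        then have "c \<noteq> 2"
          using False q2 by (auto simp: c_def)
        then have "c \<ge> 4"
          using \<open>even c\<close> cp True by presburger
        then show ?thesis
          using True by (simp add: d_def)
      next
        case False
        then have "odd p" "p \<ge> 3"
          using p1 assms(1) prime_odd_nat[of p] by auto
        then have "c \<noteq> p"
          using \<open>even c\<close> by blast
        then have "c - p \<ge> 1"
          using cp by simp
        moreover have "d \<ge> 2"
          using \<open>p \<ge> 3\<close> by (simp add: d_def)
        ultimately have "2 * 1 \<le> d * (c - p)"
          by (intro mult_le_mono)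
        then show ?thesis
          using \<open>c - p \<ge> 1\<close> \<open>p \<ge> 3\<close> by simp
      qed
      then show "c \<ge> 4" "d * (c - p) \<ge> 2"
        by blast+
    qed
    define b where "b = p * d"
    have b2: "b \<ge> 2"
      using mult_le_mono[OF p1 d1] by (simp add: b_def)
    have norm: "r ^ (d * (c - p)) * cmod (y ^ b + y ^ c - 1) = real d * cmod (y - 1)"
    proof -
      have "cmod (y ^ (d * (c - p)) * (y ^ b + y ^ c - 1)) = cmod (of_nat d * (y - 1))"
        using root by (simp add: b_def)
      then show ?thesis
        by (simp add: norm_mult norm_power r_def)
    qed
    have "r > 1/2"
    proof (rule ccontr)
      assume "\<not> r > 1/2"
      then have r2: "r \<le> 1/2"
        by simp
      \<comment> \<open>The exponents \<open>b\<close>, \<open>c\<close> and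
        \<open>d * (c - p)\<close> are all at least 2, so the left side of \<open>norm\<close> is at
        most 1/4 * 3/2 = 3/8, while the right side is at least 1/2.\<close>
      have pow: "r ^ k \<le> 1/4" if "k \<ge> 2" for k
      proof -
        have "r ^ k \<le> r ^ 2"
          using that r0 r2 by (intro power_decreasing) auto
        also have "\<dots> \<le> (1/2) ^ 2"
          using r0 r2 by (intro power_mono) auto
        finally show ?thesis
          by (simp add: power2_eq_square)
      qed
      have "cmod (y ^ b + y ^ c - 1) \<le> r ^ b + r ^ c + 1"
        using norm_triangle_ineq4[of "y ^ b + y ^ c" 1] norm_triangle_ineq[of "y ^ b" "y ^ c"]
        by (simp add: norm_power r_def)
      also have "\<dots> \<le> 3/2"
        using pow[OF b2] pow[of c] c4 by simp
      finally have "r ^ (d * (c - p)) * cmod (y ^ b + y ^ c - 1) \<le> 1/4 * (3/2)"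
        using pow[OF e2] by (intro mult_mono) auto
      moreover have "1 * (1/2) \<le> real d * cmod (y - 1)"
        using d1 r2 norm_triangle_ineq2[of 1 y]
        by (intro mult_mono) (auto simp: r_def norm_minus_commute)
      ultimately show False
        using norm by simp
    qed
    moreover have "r < 2"
    proof (rule ccontr)
      assume "\<not> r < 2"
      then have r2: "r \<ge> 2"
        by simp
      have step: "2 * r ^ (k - 1) \<le> r ^ k" if "k \<ge> 1" for k
        using that r2 by (cases k) (auto intro!: mult_right_mono)
      \<comment> \<open>For distinct exponents the larger power dominates: with l < k, r^k - r^l is
        at least 2 r^(k-1) - r^(k-1). Equal exponents cause no cancellation. The bound is stated
        with \<open>b\<close> in every case so that its exponent later combines with
        \<open>d * (c - p)\<close>.\<close>
      have gap: "r ^ (b - 1) \<le> cmod (y ^ b + y ^ c)"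
      proof -
        have *: "r ^ (k - 1) \<le> cmod (y ^ k + y ^ l)" if "l < k" for k l
        proof -
          have "r ^ l \<le> r ^ (k - 1)"
            using that r2 by (intro power_increasing) auto
          moreover have "r ^ k - r ^ l \<le> cmod (y ^ k + y ^ l)"
            using norm_diff_ineq[of "y ^ k" "y ^ l"] by (simp add: norm_power r_def)
          ultimately show ?thesis
            using step[of k] that by simp
        qed
        consider "b = c" | "c < b" | "b < c"
          by linarith
        then show ?thesis
        proof cases
          case 1
          have "r ^ (b - 1) \<le> r ^ b"
            using r2 by (intro power_increasing) auto
          moreover have "cmod (y ^ b + y ^ c) = 2 * r ^ b"
            using 1 by (simp add: norm_power norm_mult r_def flip: mult_2)
          moreover have "0 < r ^ b"
            using r0 by simp
          ultimately show ?thesis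
            by linarith
        next
          case 2
          then show ?thesis
            using * by blast
        next
          case 3
          have "r ^ (b - 1) \<le> r ^ (c - 1)"
            using 3 r2 by (intro power_increasing) auto
          then show ?thesis
            using *[OF 3] by (simp add: add.commute)
        qed
      qed
      \<comment> \<open>Giving up one more power of \<open>r\<close> absorbs the constant -1:
        r^(b-1) - 1 is at least 2 r^(b-2) - 1, hence at least r^(b-2).\<close>
      have "1 \<le> r ^ (b - 2)"
        using r2 by (intro one_le_power) auto
      moreover have "2 * r ^ (b - 2) \<le> r ^ (b - 1)"
        using step[of "b - 1"] b2 by (simp add: numeral_2_eq_2)
      moreover have "r ^ (b - 1) - 1 \<le> cmod (y ^ b + y ^ c - 1)"
        using gap norm_triangle_ineq2[of "y ^ b + y ^ c" 1] by simp
      ultimately have low: "r ^ (b - 2) \<le> cmod (y ^ b + y ^ c - 1)"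
        by linarith
      have "d * c - 2 = d * (c - p) + (b - 2)"
        using b2 exponent by (simp add: b_def)
      then have "r ^ (d * c - 2) = r ^ (d * (c - p)) * r ^ (b - 2)"
        by (simp add: power_add)
      also have "\<dots> \<le> real d * cmod (y - 1)"
        unfolding norm[symmetric] using low r0 by (intro mult_left_mono) auto
      also have "\<dots> \<le> real d * (r + 1)"
        using norm_triangle_ineq4[of y 1] by (intro mult_left_mono) (auto simp: r_def)
      finally have up: "r ^ (d * c - 2) \<le> real d * (r + 1)" .
      \<comment> \<open>Exponential growth beats the factor \<open>d\<close>: 2 d r is at most
        r^(2d), and 2 d is at most d c - 2 because \<open>c\<close> is at least 4. With
        \<open>up\<close> this gives 2 r at most r + 1, impossible for \<open>r\<close> at least
        2.\<close>
      have "2 * d - 1 < 2 ^ (2 * d - 1)"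
        by (rule less_exp)
      then have "real (2 * d) \<le> real (2 ^ (2 * d - 1))"
        by (simp only: of_nat_le_iff)
      also have "\<dots> \<le> r ^ (2 * d - 1)"
        using r2 by (simp add: power_mono)
      finally have "real (2 * d) * r \<le> r ^ (2 * d - 1) * r"
        using r0 by (intro mult_right_mono) auto
      also have "\<dots> = r ^ (2 * d)"
        using d1 by (intro power_minus_mult) simp
      also have "\<dots> \<le> r ^ (d * c - 2)"
      proof (rule power_increasing)
        have "d * 4 \<le> d * c"
          using c4 by simp
        then show "2 * d \<le> d * c - 2"
          using d1 by linarith
      qed (use r2 in simp)
      finally have "real d * (2 * r) \<le> real d * (r + 1)"
        using up by simp
      then show False
        using d1 r2 by simp
    qed
    ultimately show ?thesis
      by blast
  qed
  then show ?thesis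
    by (simp add: r_def y_def)
qed

end
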